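(* Let $T$ be the infinite ternary ($3$-regular) tree with origin $o$. A binary word $a=a_1\cdots a_n$ is an escape sequence for some initial rotor configuration on $T$ if and only if, writing $a^{(j)}=a_ja_{j+3}a_{j+6}\cdots$ for $j\in\{1,2,3\}$, for each $j$ and each $k\ge2$ every subword (block of consecutive letters) of $a^{(j)}$ of length $2^k-1$ contains at most $2^{k-1}$ ones.
   Context: Rotor-router walk on $T$: each vertex has a fixed cyclic ordering of its $3$ neighbors and a rotor pointing to one of them; a chip at $v$ first advances the rotor at $v$ to the next neighbor in the cyclic order, then moves there. Chips are started one at a time at $o$; each chip takes its first step from $o$ according to this rule and then walks until it either returns to $o$ or escapes to infinity (visits every vertex only finitely often, in which case the resulting rotor configuration is well defined); rotors are not reset between chips. Given an initial rotor configuration, its escape sequence for the first $n$ chips is the word $a_1\cdots a_n$ with $a_k=1$ if the $k$-th chip escapes to infinity and $a_k=0$ if it returns to $o$. *)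

theory Defs
  imports Main
begin

text \<open>Vertices of the 3-regular tree are reduced words over the alphabet {0,1,2}
  (elements of the free product of three copies of Z/2): lists with entries < 3 and no
  two consecutive equal entries. The origin o is the empty word. The neighbours of w are
  the words tr_move w i for i < 3.\<close>

definition tree_vertex :: "nat list \<Rightarrow> bool" where
  "tree_vertex w \<longleftrightarrow> set w \<subseteq> {..<3} \<and> successively (\<noteq>) w"

definition origin :: "nat list" where
  "origin = []"

definition tr_move :: "nat list \<Rightarrow> nat \<Rightarrow> nat list" where
  "tr_move w i = (if w \<noteq> [] \<and> last w = i then butlast w else w @ [i])"

definition tr_nbrs :: "nat list \<Rightarrow> nat list set" where
  "tr_nbrs w = {tr_move w i | i. i < 3}"

text \<open>A cyclic ordering of the neighbours at every vertex: c v is a bijection from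
  {0,1,2} onto the neighbours of v; the cyclic successor of c v i is c v ((i+1) mod 3).\<close>

definition cyclic_orders :: "(nat list \<Rightarrow> nat \<Rightarrow> nat list) \<Rightarrow> bool" where
  "cyclic_orders c \<longleftrightarrow> (\<forall>v. tree_vertex v \<longrightarrow> bij_betw (c v) {..<3} (tr_nbrs v))"

text \<open>A rotor configuration assigns to every vertex the index (in {0,1,2}) of the
  neighbour its rotor points to.\<close>

definition rotor_config :: "(nat list \<Rightarrow> nat) \<Rightarrow> bool" where
  "rotor_config \<rho> \<longleftrightarrow> (\<forall>v. \<rho> v < 3)"

definition rstep :: "(nat list \<Rightarrow> nat \<Rightarrow> nat list) \<Rightarrow>
    (nat list \<Rightarrow> nat) \<times> nat list \<Rightarrow> (nat list \<Rightarrow> nat) \<times> nat list" where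
  "rstep c s = (let \<rho> = fst s; x = snd s; r = (\<rho> x + 1) mod 3 in (\<rho>(x := r), c x r))"

definition walk :: "(nat list \<Rightarrow> nat \<Rightarrow> nat list) \<Rightarrow> (nat list \<Rightarrow> nat) \<Rightarrow> nat \<Rightarrow>
    (nat list \<Rightarrow> nat) \<times> nat list" where
  "walk c \<rho> t = (rstep c ^^ t) (\<rho>, origin)"

definition returns :: "(nat list \<Rightarrow> nat \<Rightarrow> nat list) \<Rightarrow> (nat list \<Rightarrow> nat) \<Rightarrow> bool" where
  "returns c \<rho> \<longleftrightarrow> (\<exists>t>0. snd (walk c \<rho> t) = origin)"

definition escapes :: "(nat list \<Rightarrow> nat \<Rightarrow> nat list) \<Rightarrow> (nat list \<Rightarrow> nat) \<Rightarrow> bool" where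
  "escapes c \<rho> \<longleftrightarrow> \<not> returns c \<rho> \<and> (\<forall>v. finite {t. snd (walk c \<rho> t) = v})"

definition return_config :: "(nat list \<Rightarrow> nat \<Rightarrow> nat list) \<Rightarrow> (nat list \<Rightarrow> nat) \<Rightarrow> nat list \<Rightarrow> nat" where
  "return_config c \<rho> = fst (walk c \<rho> (LEAST t. t > 0 \<and> snd (walk c \<rho> t) = origin))"

text \<open>Limiting rotor configuration of an escaping chip (each rotor is eventually constant).\<close>
definition escape_config :: "(nat list \<Rightarrow> nat \<Rightarrow> nat list) \<Rightarrow> (nat list \<Rightarrow> nat) \<Rightarrow> nat list \<Rightarrow> nat" where
  "escape_config c \<rho> = (\<lambda>v. THE r. \<exists>T. \<forall>t\<ge>T. fst (walk c \<rho> t) v = r)"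

fun is_escape_seq :: "(nat list \<Rightarrow> nat \<Rightarrow> nat list) \<Rightarrow> (nat list \<Rightarrow> nat) \<Rightarrow> bool list \<Rightarrow> bool" where
  "is_escape_seq c \<rho> [] = True"
| "is_escape_seq c \<rho> (b # w) =
     (if b then escapes c \<rho> \<and> is_escape_seq c (escape_config c \<rho>) w
      else returns c \<rho> \<and> is_escape_seq c (return_config c \<rho>) w)"

text \<open>subseq3 j a = a_{j+1} a_{j+4} a_{j+7} ... (0-indexed list, j < 3), i.e. a^{(j+1)}.\<close>
definition subseq3 :: "nat \<Rightarrow> bool list \<Rightarrow> bool list" where
  "subseq3 j a = [a ! i. i \<leftarrow> [0..<length a], i mod 3 = j]"

definition count_ones :: "bool list \<Rightarrow> nat" where
  "count_ones w = length (filter id w)"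

definition escape_condition :: "bool list \<Rightarrow> bool" where
  "escape_condition a \<longleftrightarrow>
     (\<forall>j<3. \<forall>k\<ge>2. \<forall>s. s + (2^k - 1) \<le> length (subseq3 j a) \<longrightarrow>
        count_ones (take (2^k - 1) (drop s (subseq3 j a))) \<le> 2^(k-1))"

end

theory Submission
  imports Defs "HOL-Library.Sublist" "HOL-Library.Infinite_Set"
begin

text \<open>Chips from \<open>o\<close> enter the three branches at \<open>o\<close> in turn, so the three subsequences are
  independent words of chips sent into a single branch. A branch with root \<open>v\<close> serves its first
  child, its second child and the parent cyclically: its word is \<open>1^m(0) 0 1^m(1) 0 \<dots>\<close>, where
  \<open>m(i)\<close> is the sum of the \<open>i\<close>-th letters of the two children's words. So a block with fewer than
  \<open>2^k - 1\<close> zeros has its ones coming from at most \<open>2^k - 1\<close> consecutive letters of either child,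
  and induction on \<open>k\<close> bounds them by \<open>2 * 2^(k-1)\<close>. Conversely, distributing the ones of a word
  evenly between the two children halves its block counts, so the children's words satisfy the
  condition again. They are also shorter, provided a leading zero is produced by a rotor that serves
  the parent first, except for the word \<open>1\<close>, which is realised directly; hence induction on the
  length yields the configuration.\<close>

section \<open>Sparse words\<close>

abbreviation zeros :: "bool list \<Rightarrow> nat" where
  "zeros w \<equiv> length (filter Not w)"

lemma count_ones_simps [simp]:
  "count_ones [] = 0"
  "count_ones (b # w) = (if b then Suc (count_ones w) else count_ones w)"
  "count_ones (v @ w) = count_ones v + count_ones w"
  by (auto simp: count_ones_def)

lemma count_ones_le_length: "count_ones w \<le> length w"
  by (simp add: count_ones_def)

lemma ones_plus_zeros: "count_ones w + zeros w = length w"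
  by (induction w) auto

text \<open>All blocks shorter than 2^(k+1) are bounded, not only those of length 2^(k+1) - 1, and
  \<open>k = 0\<close> is allowed; in this form the bound can be carried through inductions on
  \<open>k\<close>.\<close>

definition sparse :: "bool list \<Rightarrow> bool" where
  "sparse w \<longleftrightarrow> (\<forall>k q. sublist q w \<and> length q < 2 ^ Suc k \<longrightarrow> count_ones q \<le> 2 ^ k)"

lemma sparse_sublist: "sparse w \<Longrightarrow> sublist q w \<Longrightarrow> sparse q"
  unfolding sparse_def by (meson sublist_order.order_trans)

text \<open>From right to left: a block at least one letter short of length 2^(k+2) - 1 has at most
  2(2^(k+1) - 1) letters, so it splits into two blocks covered by the induction on \<open>k\<close>,
  and their bounds add up.\<close>

lemma sparse_iff_blocks:
  "sparse w \<longleftrightarrow> (\<forall>k\<ge>2. \<forall>s. s + (2^k - 1) \<le> length w \<longrightarrow>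
      count_ones (take (2^k - 1) (drop s w)) \<le> 2^(k-1))" (is "_ \<longleftrightarrow> ?R")
proof
  assume w: "sparse w"
  show ?R
  proof (intro allI impI)
    fix k s :: nat
    assume "2 \<le> k" "s + (2^k - 1) \<le> length w"
    then obtain j where k: "k = Suc j" by (cases k) auto
    let ?q = "take (2^k - 1) (drop s w)"
    have "sublist ?q w"
      by (meson sublist_drop sublist_order.order_trans sublist_take)
    moreover have "length ?q < 2 ^ Suc j"
      using k by (simp add: min_def) (metis One_nat_def Suc_pred le_imp_less_Suc zero_less_numeral
        nat_0_less_mult_iff zero_less_power)
    ultimately show "count_ones ?q \<le> 2 ^ (k - 1)"
      using w k unfolding sparse_def by (metis diff_Suc_1)
  qed
next
  assume R: ?R
  have "count_ones q \<le> 2 ^ k" if "sublist q w" "length q < 2 ^ Suc k" for k q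
    using that
  proof (induction k arbitrary: q)
    case 0
    then show ?case using count_ones_le_length[of q] by simp
  next
    case (Suc k)
    define n :: nat where "n = 2 ^ Suc k - 1"
    have n: "2 ^ Suc k = Suc n" unfolding n_def by simp
    show ?case
    proof (cases "length q = 2 ^ Suc (Suc k) - 1")
      case True
      obtain p r where w: "w = p @ q @ r" using Suc.prems(1) by (auto simp: sublist_def)
      have "take (2 ^ Suc (Suc k) - 1) (drop (length p) w) = q"
        using True w by simp
      moreover have "length p + (2 ^ Suc (Suc k) - 1) \<le> length w"
        using True w by simp
      ultimately show ?thesis
        using R[rule_format, of "Suc (Suc k)" "length p"] by simp
    next
      case False
      have len: "length q \<le> n + n"
        using False Suc.prems(2) n by simp
      have "count_ones (take n q) \<le> 2 ^ k"
        using Suc.prems(1) n by (intro Suc.IH) (auto intro: sublist_order.order_trans)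
      moreover have "count_ones (drop n q) \<le> 2 ^ k"
        using Suc.prems(1) n len by (intro Suc.IH) (auto intro: sublist_order.order_trans)
      moreover have "count_ones q = count_ones (take n q) + count_ones (drop n q)"
        by (metis append_take_drop_id count_ones_simps(3))
      ultimately show ?thesis by simp
    qed
  qed
  then show "sparse w" unfolding sparse_def by blast
qed

lemma escape_condition_iff_sparse:
  "escape_condition a \<longleftrightarrow> (\<forall>j<3. sparse (subseq3 j a))"
  unfolding escape_condition_def sparse_iff_blocks by blast

lemma prefix_with_ones:
  "n \<le> count_ones q \<Longrightarrow> \<exists>p. prefix p q \<and> count_ones p = n"
proof (induction q rule: rev_induct)
  case (snoc b q)
  show ?case
  proof (cases "n \<le> count_ones q")
    case True
    then show ?thesis using snoc.IH by (meson prefix_prefix)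
  next
    case False
    then have "n = count_ones (q @ [b])" using snoc.prems by (auto split: if_splits)
    then show ?thesis by blast
  qed
qed auto

text \<open>A prefix of \<open>q\<close> with exactly 2^k + 1 ones would have at most 2^k - 2 zeros,
  hence length below 2^(k+1), against sparsity. This trades the bound on the length for one on the
  zeros, which are what the rounds of a rotor control.\<close>

lemma sparse_zeros:
  assumes "sparse w" "sublist q w" "Suc (zeros q) < 2 ^ k"
  shows "count_ones q \<le> 2 ^ k"
proof (rule ccontr)
  assume "\<not> ?thesis"
  then obtain p where p: "prefix p q" "count_ones p = Suc (2 ^ k)"
    using prefix_with_ones[of "Suc (2 ^ k)" q] by auto
  from p(1) have "zeros p \<le> zeros q" by (auto simp: prefix_def)
  then have "length p < 2 ^ Suc k"
    using ones_plus_zeros[of p] p(2) assms(3) by simp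
  moreover have "sublist p w"
    using p(1) assms(2) by (meson prefix_imp_sublist sublist_order.order_trans)
  ultimately have "count_ones p \<le> 2 ^ k"
    using assms(1) unfolding sparse_def by blast
  then show False using p(2) by simp
qed

text \<open>\<open>half t w\<close> is the word given to one of the children: blocks \<open>10\<close> go to the two children
  alternately, and \<open>t\<close> says whether this child receives the next one. A block \<open>110\<close> gives a one to
  each child; \<open>tl\<close> drops its final zero, and does nothing if the word ends before it.\<close>
fun half :: "bool \<Rightarrow> bool list \<Rightarrow> bool list" where
  "half t [] = []"
| "half t (False # w) = False # half t w"
| "half t [True] = [t]"
| "half t (True # False # w) = t # half (\<not> t) w"
| "half t (True # True # w) = True # half t (tl w)"

lemma length_half: "length (half t w) \<le> length w"
  by (induction t w rule: half.induct) auto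

text \<open>At least two letters are absorbed into the first one, so recursion on the length can
  proceed. The word \<open>[True]\<close> is left out because its half has the same length.\<close>

lemma length_half_less: "length (half t (True # b # w)) < length (True # b # w)"
  using length_half[of "\<not> t" w] length_half[of t "tl w"] by (cases b) auto

text \<open>Each letter of a half consumes at most one zero of \<open>w\<close>, and
  \<open>p\<close> stops before the zero consumed by the last letter. Blocks with a single one
  alternate between the children, so a child is ahead of its fair share by at most one, and only if
  \<open>t\<close> gives it the first such block.\<close>

lemma half_prefix:
  assumes "prefix q (half t w)" "q \<noteq> []"
  shows "\<exists>p. prefix p w \<and> zeros p < length q \<and> 2 * count_ones q \<le> count_ones p + of_bool t"
  using assms
proof (induction t w arbitrary: q rule: half.induct)
  case (1 t)
  then show ?case by simp
next
  case (2 t w)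
  then obtain q' where q: "q = False # q'" "prefix q' (half t w)" by (cases q) auto
  show ?case
  proof (cases "q' = []")
    case True
    then show ?thesis using q by (intro exI[of _ "[]"]) auto
  next
    case False
    with "2.IH" q obtain p where "prefix p w" "zeros p < length q'"
      "2 * count_ones q' \<le> count_ones p + of_bool t" by blast
    then show ?thesis using q by (intro exI[of _ "False # p"]) auto
  qed
next
  case (3 t)
  then have "q = [t]" by (cases q) auto
  then show ?case by (intro exI[of _ "[True]"]) auto
next
  case (4 t w)
  then obtain q' where q: "q = t # q'" "prefix q' (half (\<not> t) w)" by (cases q) auto
  show ?case
  proof (cases "q' = []")
    case True
    then show ?thesis using q by (intro exI[of _ "[True]"]) auto
  next
    case False
    with "4.IH" q obtain p where "prefix p w" "zeros p < length q'"
      "2 * count_ones q' \<le> count_ones p + of_bool (\<not> t)" by blast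
    then show ?thesis using q by (intro exI[of _ "True # False # p"]) auto
  qed
next
  case (5 t w)
  then obtain q' where q: "q = True # q'" "prefix q' (half t (tl w))" by (cases q) auto
  show ?case
  proof (cases "q' = [] \<or> w = []")
    case True
    then show ?thesis using q by (intro exI[of _ "[True, True]"]) auto
  next
    case False
    with "5.IH" q obtain p where "prefix p (tl w)" "zeros p < length q'"
      "2 * count_ones q' \<le> count_ones p + of_bool t" by blast
    moreover obtain b w' where "w = b # w'" using False by (cases w) auto
    ultimately show ?thesis using q by (intro exI[of _ "True # True # b # p"]) auto
  qed
qed

text \<open>The only memory of \<open>half\<close> is its flag, so its output from some point on is
  a half of the unread rest. Together with \<open>half_prefix\<close> this reaches arbitrary
  blocks.\<close>

lemma half_suffix:
  "suffix s (half t w) \<Longrightarrow> \<exists>t' w'. suffix w' w \<and> s = half t' w'"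
proof (induction t w rule: half.induct)
  case (1 t)
  then show ?case by (auto intro: exI[of _ "[]"])
next
  case (2 t w)
  then show ?case by (metis half.simps(2) suffix_Cons suffix_order.order_refl)
next
  case (3 t)
  then show ?case by (metis half.simps(1,3) suffix_Cons suffix_bot.bot_least suffix_order.order_refl suffix_bot.extremum_uniqueI)
next
  case (4 t w)
  then show ?case by (metis half.simps(4) suffix_Cons suffix_order.order_refl)
next
  case (5 t w)
  show ?case
  proof (cases "s = half t (True # True # w)")
    case False
    then obtain t' w' where "suffix w' (tl w)" "s = half t' w'"
      using 5 by (auto simp: suffix_Cons)
    moreover have "suffix (tl w) (True # True # w)"
      by (meson suffix_Cons suffix_order.order_trans suffix_tl)
    ultimately show ?thesis using suffix_order.order_trans by blast
  qed blast
qed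

text \<open>A block of fewer than 2^(k+1) letters comes from a block of \<open>w\<close> with fewer
  than 2^(k+1) - 1 zeros, to which \<open>sparse_zeros\<close> applies. Twice the number of ones is
  then at most 2^(k+1) + 1, and parity removes the excess.\<close>

lemma sparse_half:
  assumes "sparse w"
  shows "sparse (half t w)"
  unfolding sparse_def
proof (intro allI impI, elim conjE)
  fix k q
  assume q: "sublist q (half t w)" "length q < 2 ^ Suc k"
  show "count_ones q \<le> 2 ^ k"
  proof (cases "k = 0 \<or> q = []")
    case True
    then show ?thesis using q(2) count_ones_le_length[of q] by auto
  next
    case False
    obtain s where s: "suffix s (half t w)" "prefix q s"
      using q(1) by (meson sublist_altdef')
    obtain t' w' where w': "suffix w' w" "s = half t' w'" using half_suffix[OF s(1)] by blast
    obtain p where p: "prefix p w'" "zeros p < length q"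
      "2 * count_ones q \<le> count_ones p + of_bool t'"
      using half_prefix[of q t' w'] s(2) w'(2) False by blast
    have "sublist p w" using p(1) w'(1) by (meson sublist_altdef')
    then have "count_ones p \<le> 2 ^ Suc k"
      using p(2) q(2) by (intro sparse_zeros[OF assms]) auto
    then show ?thesis using p(3) by (cases t') auto
  qed
qed

text \<open>Ensures that the letter dropped by \<open>tl\<close> in the last clause of
  \<open>half\<close> is a zero.\<close>

lemma not_sparse_111: "\<not> sparse (True # True # True # w)"
proof
  assume "sparse (True # True # True # w)"
  moreover have "sublist [True, True, True] (True # True # True # w)"
    by (intro prefix_imp_sublist) simp
  moreover have "length [True, True, True] < 2 ^ Suc 1" by simp
  ultimately have "count_ones [True, True, True] \<le> 2 ^ 1"
    unfolding sparse_def by blast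
  then show False by simp
qed

section \<open>The walk in a branch\<close>

locale rotor_tree =
  fixes c :: "nat list \<Rightarrow> nat \<Rightarrow> nat list"
  assumes cyclic: "cyclic_orders c"
begin

abbreviation steps ::
  "nat \<Rightarrow> (nat list \<Rightarrow> nat) \<times> nat list \<Rightarrow> (nat list \<Rightarrow> nat) \<times> nat list" where
  "steps t s \<equiv> (rstep c ^^ t) s"

section \<open>First arrival at a vertex, and the configuration left behind\<close>

definition hits :: "nat list \<Rightarrow> (nat list \<Rightarrow> nat) \<times> nat list \<Rightarrow> bool" where
  "hits y s \<longleftrightarrow> (\<exists>t. snd (steps t s) = y)"

definition limit_config :: "(nat list \<Rightarrow> nat) \<times> nat list \<Rightarrow> nat list \<Rightarrow> nat" where
  "limit_config s = (\<lambda>x. THE r. \<exists>T. \<forall>t\<ge>T. fst (steps t s) x = r)"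

text \<open>Treats returning and escaping chips uniformly. The limit uses the same
  \<open>THE\<close> expression as \<open>escape_config\<close>, so the two can be identified
  directly.\<close>

definition final_config :: "nat list \<Rightarrow> (nat list \<Rightarrow> nat) \<times> nat list \<Rightarrow> nat list \<Rightarrow> nat" where
  "final_config y s = (if hits y s then fst (steps (LEAST t. snd (steps t s) = y) s)
     else limit_config s)"

lemma steps_Suc: "steps (Suc t) s = steps t (rstep c s)"
  by (simp add: funpow_swap1)

lemma limit_config_rstep: "limit_config (rstep c s) = limit_config s"
proof
  fix x
  have "(\<exists>T. \<forall>t\<ge>T. fst (steps (Suc t) s) x = r) = (\<exists>T. \<forall>t\<ge>T. fst (steps t s) x = r)" for r
    by (metis Suc_le_D Suc_le_mono le_SucI)
  then show "limit_config (rstep c s) x = limit_config s x"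
    unfolding limit_config_def steps_Suc by simp
qed

lemma hits_rstep: "snd s \<noteq> y \<Longrightarrow> hits y (rstep c s) = hits y s"
  unfolding hits_def steps_Suc[symmetric] by (metis funpow_0 not0_implies_Suc)

lemma final_config_rstep:
  assumes "snd s \<noteq> y"
  shows "final_config y (rstep c s) = final_config y s"
proof (cases "hits y s")
  case True
  then obtain n where "snd (steps n s) = y" unfolding hits_def by blast
  then have "(LEAST t. snd (steps t s) = y) = Suc (LEAST t. snd (steps (Suc t) s) = y)"
    using assms by (intro Least_Suc) auto
  then show ?thesis
    using True hits_rstep[OF assms] unfolding final_config_def by (simp add: steps_Suc del: funpow.simps)
next
  case False
  then show ?thesis
    using hits_rstep[OF assms] unfolding final_config_def by (simp add: limit_config_rstep)
qed

lemma shift_steps: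
  "(\<And>t. t < n \<Longrightarrow> snd (steps t s) \<noteq> y) \<Longrightarrow>
     hits y (steps n s) = hits y s \<and> final_config y (steps n s) = final_config y s"
  by (induction n) (auto simp: hits_rstep final_config_rstep)

lemma hits_self [simp]: "hits y (\<rho>, y)"
  unfolding hits_def by (rule exI[of _ 0]) simp

lemma final_config_self [simp]: "final_config y (\<rho>, y) = \<rho>"
proof -
  have "(LEAST t. snd (steps t (\<rho>, y)) = y) = 0" by (rule Least_eq_0) simp
  then show ?thesis by (simp add: final_config_def)
qed

lemma rstep_eq: "rstep c (\<rho>, x) = (\<rho>(x := (\<rho> x + 1) mod 3), c x ((\<rho> x + 1) mod 3))"
  by (simp add: rstep_def Let_def)

section \<open>Neighbours in the tree and confinement to a branch\<close>

lemma bij_c: "tree_vertex x \<Longrightarrow> bij_betw (c x) {..<3} (tr_nbrs x)"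
  using cyclic by (simp add: cyclic_orders_def)

lemma c_nbr: "tree_vertex x \<Longrightarrow> i < 3 \<Longrightarrow> c x i \<in> tr_nbrs x"
  using bij_c by (auto simp: bij_betw_def)

lemma nbr_cases:
  assumes "y \<in> tr_nbrs x"
  obtains "x \<noteq> []" "y = butlast x" | i where "y = x @ [i]"
  using assms by (auto simp: tr_nbrs_def tr_move_def split: if_splits)

lemma nbr_vertex:
  assumes "tree_vertex x" "y \<in> tr_nbrs x"
  shows "tree_vertex y"
proof -
  obtain i where i: "i < 3" "y = tr_move x i" using assms(2) by (auto simp: tr_nbrs_def)
  show ?thesis
  proof (cases "x \<noteq> [] \<and> last x = i")
    case True
    then have "x = y @ [last x]" using i by (auto simp: tr_move_def)
    then show ?thesis using assms(1) unfolding tree_vertex_def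
      by (metis Un_subset_iff set_append successively_append_iff)
  next
    case False
    then show ?thesis using assms(1) i
      by (auto simp: tr_move_def tree_vertex_def successively_append_iff)
  qed
qed

lemma parent_nbr:
  assumes "tree_vertex v" "v \<noteq> []"
  shows "butlast v \<in> tr_nbrs v"
proof -
  have "last v < 3" using assms last_in_set[of v] unfolding tree_vertex_def by blast
  then show ?thesis using assms by (auto simp: tr_nbrs_def tr_move_def)
qed

lemma rstep_nbr: "tree_vertex x \<Longrightarrow> snd (rstep c (\<rho>, x)) \<in> tr_nbrs x"
  by (simp add: rstep_eq c_nbr)

lemma butlast_neq: "v \<noteq> [] \<Longrightarrow> butlast v \<noteq> v"
  by (metis append_butlast_last_id append_self_conv list.distinct(1))

text \<open>Only the edge from \<open>v\<close> to its parent leaves the branch: a child extends the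
  current word, and the parent of a proper extension of \<open>v\<close> still extends
  \<open>v\<close>.\<close>

lemma stay_in_branch:
  assumes "tree_vertex v" "v \<noteq> []" "\<And>s. s < t \<Longrightarrow> snd (steps s (\<rho>, v)) \<noteq> butlast v"
  shows "tree_vertex (snd (steps t (\<rho>, v)))
    \<and> (prefix v (snd (steps t (\<rho>, v))) \<or> snd (steps t (\<rho>, v)) = butlast v)
    \<and> (\<forall>x. \<not> prefix v x \<longrightarrow> fst (steps t (\<rho>, v)) x = \<rho> x)"
  using assms(3)
proof (induction t)
  case 0
  then show ?case using assms(1) by simp
next
  case (Suc t)
  obtain \<rho>' x where s: "steps t (\<rho>, v) = (\<rho>', x)" by fastforce
  have "x \<noteq> butlast v" using Suc.prems[of t] s by simp
  then have IH: "tree_vertex x" "prefix v x" "\<forall>y. \<not> prefix v y \<longrightarrow> \<rho>' y = \<rho> y"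
    using Suc.IH Suc.prems s by (auto simp: less_Suc_eq)
  let ?y = "snd (rstep c (\<rho>', x))"
  have y: "?y \<in> tr_nbrs x" using IH(1) by (rule rstep_nbr)
  have "prefix v ?y \<or> ?y = butlast v"
    using y
  proof (cases rule: nbr_cases)
    case 1
    then show ?thesis using IH(2)
      by (metis append_butlast_last_id prefix_snoc)
  next
    case (2 i)
    then show ?thesis using IH(2) by simp
  qed
  then show ?case
    using IH nbr_vertex[OF IH(1) y] s by (auto simp: rstep_eq)
qed

text \<open>Before its exit the walk reads only rotors inside the branch. This is what allows
  configurations of disjoint branches to be glued.\<close>

lemma steps_local:
  assumes "tree_vertex v" "v \<noteq> []" "\<And>s. s < t \<Longrightarrow> snd (steps s (\<rho>, v)) \<noteq> butlast v"
    and agree: "\<And>x. prefix v x \<Longrightarrow> \<rho> x = \<rho>' x"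
  shows "snd (steps t (\<rho>, v)) = snd (steps t (\<rho>', v))
    \<and> (\<forall>x. prefix v x \<longrightarrow> fst (steps t (\<rho>, v)) x = fst (steps t (\<rho>', v)) x)"
  using assms(3)
proof (induction t)
  case 0
  then show ?case using agree by simp
next
  case (Suc t)
  obtain \<sigma> x where s: "steps t (\<rho>, v) = (\<sigma>, x)" by fastforce
  obtain \<sigma>' x' where s': "steps t (\<rho>', v) = (\<sigma>', x')" by fastforce
  have "x \<noteq> butlast v" using Suc.prems[of t] s by simp
  then have "prefix v x"
    using stay_in_branch[OF assms(1,2), of t \<rho>] Suc.prems s by (auto simp: less_Suc_eq)
  then show ?case using Suc.IH Suc.prems s s' by (auto simp: rstep_eq)
qed

lemma hits_local:
  assumes "tree_vertex v" "v \<noteq> []" and agree: "\<And>x. prefix v x \<Longrightarrow> \<rho> x = \<rho>' x"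
  shows "hits (butlast v) (\<rho>, v) = hits (butlast v) (\<rho>', v)"
proof -
  \<comment> \<open>The two configurations play symmetric roles, so one implication for a generic
    pair suffices.\<close>
  have "hits (butlast v) (\<rho>2, v)"
    if h: "hits (butlast v) (\<rho>1, v)" and ag: "\<And>x. prefix v x \<Longrightarrow> \<rho>1 x = \<rho>2 x" for \<rho>1 \<rho>2
  proof -
    let ?T = "LEAST t. snd (steps t (\<rho>1, v)) = butlast v"
    have "snd (steps ?T (\<rho>1, v)) = butlast v"
      using h unfolding hits_def by (rule LeastI_ex)
    moreover have "snd (steps s (\<rho>1, v)) \<noteq> butlast v" if "s < ?T" for s
      using not_less_Least[OF that] .
    ultimately show ?thesis
      using steps_local[OF assms(1,2), of ?T \<rho>1 \<rho>2] ag unfolding hits_def by metis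
  qed
  then show ?thesis using agree by metis
qed

lemma final_config_local:
  assumes "tree_vertex v" "v \<noteq> []" and agree: "\<And>x. prefix v x \<Longrightarrow> \<rho> x = \<rho>' x"
    and x: "prefix v x"
  shows "final_config (butlast v) (\<rho>, v) x = final_config (butlast v) (\<rho>', v) x"
proof (cases "hits (butlast v) (\<rho>, v)")
  case True
  let ?T = "LEAST t. snd (steps t (\<rho>, v)) = butlast v"
  let ?T' = "LEAST t. snd (steps t (\<rho>', v)) = butlast v"
  have T: "snd (steps ?T (\<rho>, v)) = butlast v"
    using True unfolding hits_def by (rule LeastI_ex)
  have loc: "snd (steps t (\<rho>, v)) = snd (steps t (\<rho>', v))
      \<and> (\<forall>x. prefix v x \<longrightarrow> fst (steps t (\<rho>, v)) x = fst (steps t (\<rho>', v)) x)" if "t \<le> ?T" for t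
  proof (rule steps_local[OF assms(1,2) _ agree])
    fix s assume "s < t"
    then show "snd (steps s (\<rho>, v)) \<noteq> butlast v"
      using not_less_Least[of s] that by (meson less_le_trans)
  qed
  have "?T' = ?T"
  proof (rule Least_equality)
    show "snd (steps ?T (\<rho>', v)) = butlast v" using loc[of ?T] T by simp
    fix t assume t: "snd (steps t (\<rho>', v)) = butlast v"
    show "?T \<le> t"
    proof (rule ccontr)
      assume "\<not> ?T \<le> t"
      then show False using loc[of t] t not_less_Least[of t "\<lambda>t. snd (steps t (\<rho>, v)) = butlast v"]
        by simp
    qed
  qed
  then show ?thesis
    using True hits_local[OF assms(1,2) agree] loc[of ?T] x unfolding final_config_def by simp
next
  case False
  then have "fst (steps t (\<rho>, v)) x = fst (steps t (\<rho>', v)) x" for t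
    using steps_local[OF assms(1,2), of t \<rho> \<rho>'] agree x unfolding hits_def by metis
  then show ?thesis
    using False hits_local[OF assms(1,2) agree] unfolding final_config_def limit_config_def by simp
qed

lemma final_config_outside:
  assumes "tree_vertex v" "v \<noteq> []" and x: "\<not> prefix v x"
  shows "final_config (butlast v) (\<rho>, v) x = \<rho> x"
proof (cases "hits (butlast v) (\<rho>, v)")
  case True
  let ?T = "LEAST t. snd (steps t (\<rho>, v)) = butlast v"
  have "snd (steps s (\<rho>, v)) \<noteq> butlast v" if "s < ?T" for s
    using not_less_Least[OF that] .
  then show ?thesis
    using True stay_in_branch[OF assms(1,2), of ?T \<rho>] x unfolding final_config_def by simp
next
  case False
  then have "fst (steps t (\<rho>, v)) x = \<rho> x" for t
    using stay_in_branch[OF assms(1,2), of t \<rho>] x unfolding hits_def by blast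
  then show ?thesis
    using False unfolding final_config_def limit_config_def by auto
qed

text \<open>Only the parent must never be reached; that every vertex is then visited finitely often
  is \<open>finite_visits\<close>.\<close>

definition branch_escapes :: "nat list \<Rightarrow> (nat list \<Rightarrow> nat) \<Rightarrow> bool" where
  "branch_escapes v \<rho> \<longleftrightarrow> \<not> hits (butlast v) (\<rho>, v)"

definition branch_next :: "nat list \<Rightarrow> (nat list \<Rightarrow> nat) \<Rightarrow> nat list \<Rightarrow> nat" where
  "branch_next v \<rho> = final_config (butlast v) (\<rho>, v)"

fun branch_word :: "nat list \<Rightarrow> (nat list \<Rightarrow> nat) \<Rightarrow> bool list \<Rightarrow> bool" where
  "branch_word v \<rho> [] = True"
| "branch_word v \<rho> (b # w) = (b = branch_escapes v \<rho> \<and> branch_word v (branch_next v \<rho>) w)"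

lemma branch_word_local:
  assumes "tree_vertex v" "v \<noteq> []" "\<And>x. prefix v x \<Longrightarrow> \<rho> x = \<rho>' x"
  shows "branch_word v \<rho> w = branch_word v \<rho>' w"
  using assms(3)
proof (induction w arbitrary: \<rho> \<rho>')
  case (Cons b w)
  have "branch_word v (branch_next v \<rho>) w = branch_word v (branch_next v \<rho>') w"
    using Cons.prems unfolding branch_next_def
    by (intro Cons.IH final_config_local[OF assms(1,2)])
  then show ?case
    using hits_local[OF assms(1,2) Cons.prems] by (auto simp: branch_escapes_def)
qed simp

lemma branch_to_parent:
  assumes "v \<noteq> []" "c v ((\<rho> v + 1) mod 3) = butlast v"
  shows "\<not> branch_escapes v \<rho>" "branch_next v \<rho> = \<rho>(v := (\<rho> v + 1) mod 3)"
  using hits_rstep[of "(\<rho>, v)" "butlast v"] final_config_rstep[of "(\<rho>, v)" "butlast v"]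
    assms butlast_neq[OF assms(1)]
  by (simp_all add: branch_escapes_def branch_next_def rstep_eq)

text \<open>An excursion into the branch of \<open>u\<close> can reach the parent of
  \<open>v\<close> only through \<open>v\<close>. So the chip either never comes back, or on its
  first return to \<open>v\<close> behaves like a fresh chip started there in the configuration left
  by the excursion.\<close>

lemma branch_to_child:
  fixes \<rho> v
  defines "r \<equiv> (\<rho> v + 1) mod 3"
  defines "\<rho>1 \<equiv> \<rho>(v := r)"
  assumes v: "tree_vertex v" "v \<noteq> []" and u: "u = c v r" "u \<noteq> butlast v"
  shows "branch_escapes v \<rho> \<longleftrightarrow> branch_escapes u \<rho>1 \<or> branch_escapes v (branch_next u \<rho>1)"
    and "branch_next v \<rho> =
      (if branch_escapes u \<rho>1 then branch_next u \<rho>1 else branch_next v (branch_next u \<rho>1))"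
proof -
  have nb: "u \<in> tr_nbrs v" using c_nbr[OF v(1), of r] u by (simp add: r_def)
  then obtain i where i: "u = v @ [i]" using u(2) by (elim nbr_cases) auto
  have u': "tree_vertex u" "u \<noteq> []" "butlast u = v" using nbr_vertex[OF v(1) nb] i by auto
  have step: "hits (butlast v) (\<rho>, v) = hits (butlast v) (\<rho>1, u)"
    "final_config (butlast v) (\<rho>, v) = final_config (butlast v) (\<rho>1, u)"
    "limit_config (\<rho>, v) = limit_config (\<rho>1, u)"
    using hits_rstep[of "(\<rho>, v)" "butlast v"] final_config_rstep[of "(\<rho>, v)" "butlast v"]
      limit_config_rstep[of "(\<rho>, v)"] butlast_neq[OF v(2)] u(1)
    by (simp_all add: rstep_eq \<rho>1_def r_def)
  have np: "\<not> prefix u (butlast v)" "butlast v \<noteq> v"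
    using v(2) i by (auto dest: prefix_length_le simp: butlast_neq)
  have away: "snd (steps t (\<rho>1, u)) \<noteq> butlast v"
    if "\<And>s. s < t \<Longrightarrow> snd (steps s (\<rho>1, u)) \<noteq> v" for t
    using stay_in_branch[OF u'(1,2), of t \<rho>1] that np u'(3) by metis
  have "(branch_escapes v \<rho> \<longleftrightarrow> branch_escapes u \<rho>1 \<or> branch_escapes v (branch_next u \<rho>1)) \<and>
    branch_next v \<rho> =
      (if branch_escapes u \<rho>1 then branch_next u \<rho>1 else branch_next v (branch_next u \<rho>1))"
  proof (cases "hits v (\<rho>1, u)")
    case True
    let ?T = "LEAST t. snd (steps t (\<rho>1, u)) = v"
    have T: "snd (steps ?T (\<rho>1, u)) = v" using True unfolding hits_def by (rule LeastI_ex)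
    have bef: "snd (steps s (\<rho>1, u)) \<noteq> v" if "s < ?T" for s using not_less_Least[OF that] .
    have nx: "branch_next u \<rho>1 = fst (steps ?T (\<rho>1, u))"
      using True u'(3) by (simp add: branch_next_def final_config_def)
    have "steps ?T (\<rho>1, u) = (branch_next u \<rho>1, v)" using T nx by (metis prod.collapse)
    moreover have "snd (steps s (\<rho>1, u)) \<noteq> butlast v" if "s < ?T" for s
      using away bef that by (meson less_trans)
    ultimately have "hits (butlast v) (branch_next u \<rho>1, v) = hits (butlast v) (\<rho>1, u)"
      "final_config (butlast v) (branch_next u \<rho>1, v) = final_config (butlast v) (\<rho>1, u)"
      using shift_steps[of ?T "(\<rho>1, u)" "butlast v"] by auto
    then show ?thesis using step True u'(3)
      by (simp add: branch_escapes_def branch_next_def)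
  next
    case False
    then have "\<not> hits (butlast v) (\<rho>1, u)" using away unfolding hits_def by blast
    then show ?thesis using step False u'(3)
      by (simp add: branch_escapes_def branch_next_def final_config_def)
  qed
  then show "branch_escapes v \<rho> \<longleftrightarrow> branch_escapes u \<rho>1 \<or> branch_escapes v (branch_next u \<rho>1)"
    and "branch_next v \<rho> =
      (if branch_escapes u \<rho>1 then branch_next u \<rho>1 else branch_next v (branch_next u \<rho>1))"
    by blast+
qed

lemma mod3_shift_neq:
  fixes p d :: nat
  assumes "p < 3" "d < 2"
  shows "(p + Suc d) mod 3 \<noteq> p"
proof -
  have "p = 0 \<or> p = 1 \<or> p = 2" "d = 0 \<or> d = 1" using assms by linarith+
  then show ?thesis by (elim disjE) simp_all
qed

text \<open>Successive departures from \<open>x\<close> use successive directions of its rotor, so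
  infinitely many visits use each of the three directions infinitely often.\<close>

lemma infinite_visits_nbr:
  assumes x: "tree_vertex x" "infinite {t. snd (steps t s) = x}" and y: "y \<in> tr_nbrs x"
  shows "infinite {t. snd (steps t s) = y}"
proof -
  \<comment> \<open>\<open>D i\<close> holds the times at which the chip leaves \<open>x\<close> in
    direction \<open>i\<close>; the rotor is read after its advance, hence at
    \<open>Suc t\<close>.\<close>
  define D where "D i = {t. snd (steps t s) = x \<and> fst (steps (Suc t) s) x = i}" for i
  have rot: "fst (steps (Suc t) s) x =
      (if snd (steps t s) = x then (fst (steps t s) x + 1) mod 3 else fst (steps t s) x)" for t
    by (cases "steps t s") (auto simp: rstep_eq)
  have "{t. snd (steps t s) = x} = (\<Union>i<3. D i)"
    using rot unfolding D_def by auto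
  then obtain i where i: "i < 3" "infinite (D i)"
    using x(2) by (metis finite_UN_I finite_lessThan lessThan_iff)
  have next_dir: "infinite (D ((i + 1) mod 3))" if D: "infinite (D i)" for i
    unfolding infinite_nat_iff_unbounded_le
  proof
    fix m
    obtain t where t: "m \<le> t" "t \<in> D i"
      using D unfolding infinite_nat_iff_unbounded_le by blast
    define t' where "t' = (LEAST n. t < n \<and> snd (steps n s) = x)"
    have "\<exists>n. t < n \<and> snd (steps n s) = x"
      using x(2) unfolding infinite_nat_iff_unbounded by blast
    then have t': "t < t'" "snd (steps t' s) = x" unfolding t'_def by (metis (mono_tags, lifting) LeastI)+
    have unvisited: "snd (steps n s) \<noteq> x" if "t < n" "n < t'" for n
      using not_less_Least[of n "\<lambda>n. t < n \<and> snd (steps n s) = x"] that unfolding t'_def by blast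
    \<comment> \<open>Between two visits the rotor at \<open>x\<close> rests, so a departure in
      direction \<open>i\<close> is followed by one in direction \<open>i + 1\<close> modulo
      3.\<close>
    have "fst (steps n s) x = i" if "Suc t \<le> n" "n \<le> t'" for n
      using that
    proof (induction n rule: dec_induct)
      case base
      then show ?case using t(2) by (simp add: D_def)
    next
      case (step n)
      then show ?case using rot[of n] unvisited[of n] by simp
    qed
    then have "t' \<in> D ((i + 1) mod 3)" using t' rot[of t'] unfolding D_def by simp
    then show "\<exists>n\<ge>m. n \<in> D ((i + 1) mod 3)" using t t' by (metis less_imp_le order_trans)
  qed
  obtain j where j: "j < 3" "y = c x j"
    using bij_c[OF x(1)] y by (auto simp: bij_betw_def)
  have "infinite (D ((i + 1) mod 3))" "infinite (D (((i + 1) mod 3 + 1) mod 3))"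
    using next_dir i(2) by blast+
  moreover have "j = i \<or> j = (i + 1) mod 3 \<or> j = ((i + 1) mod 3 + 1) mod 3"
    using i(1) j(1) by (auto simp: mod_Suc)
  ultimately have "infinite (D j)" using i(2) by blast
  moreover have "snd (steps (Suc t) s) = y" if "t \<in> D j" for t
    using that j(2) unfolding D_def by (cases "steps t s") (auto simp: rstep_eq)
  then have "Suc ` D j \<subseteq> {t. snd (steps t s) = y}" by blast
  ultimately show ?thesis by (meson finite_imageD finite_subset inj_Suc inj_on_subset subset_UNIV)
qed

text \<open>Infinitely many visits pass from a vertex to its parent; climbing in this way up to the
  parent of \<open>v\<close> contradicts escape.\<close>

lemma finite_visits:
  assumes v: "tree_vertex v" "v \<noteq> []" and esc: "branch_escapes v \<rho>"
  shows "finite {t. snd (steps t (\<rho>, v)) = x}"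
proof (rule ccontr)
  have never: "snd (steps t (\<rho>, v)) \<noteq> butlast v" for t
    using esc unfolding branch_escapes_def hits_def by blast
  assume inf: "infinite {t. snd (steps t (\<rho>, v)) = x}"
  then obtain t where "snd (steps t (\<rho>, v)) = x" using not_finite_existsD by blast
  then have "tree_vertex x" "prefix v x"
    using stay_in_branch[OF v, of t \<rho>] never by auto
  then show False using inf
  proof (induction "length x" arbitrary: x)
    case 0
    then show ?case using v(2) by simp
  next
    case (Suc n)
    then have "x \<noteq> []" by auto
    then have x: "x \<noteq> []" "butlast x \<in> tr_nbrs x" using parent_nbr[OF Suc.prems(1)] by auto
    have inf: "infinite {t. snd (steps t (\<rho>, v)) = butlast x}"
      using infinite_visits_nbr Suc x(2) by blast
    show ?case
    proof (cases "x = v")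
      case True
      then show ?thesis using inf never by simp
    next
      case False
      then have "prefix v (butlast x)" using Suc.prems(2) x(1)
        by (metis append_butlast_last_id prefix_snoc)
      then show ?thesis
        using Suc.hyps(1)[of "butlast x"] inf nbr_vertex[OF Suc.prems(1) x(2)]
        by (simp flip: Suc.hyps(2))
    qed
  qed
qed

lemma child_visit:
  fixes \<rho> v r
  defines "\<rho>1 \<equiv> \<rho>(v := r)"
  assumes v: "tree_vertex v" and r: "r < 3" and u: "u = c v r" "v = [] \<or> u \<noteq> butlast v"
  shows "branch_next u \<rho>1 v = r"
    and "branch_word u \<rho> (x # A) \<longleftrightarrow> x = branch_escapes u \<rho>1 \<and> branch_word u (branch_next u \<rho>1) A"
    and "\<And>r'. r' < 3 \<Longrightarrow> r' \<noteq> r \<Longrightarrow> v = [] \<or> c v r' \<noteq> butlast v \<Longrightarrow>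
      branch_word (c v r') (branch_next u \<rho>1) A = branch_word (c v r') \<rho> A"
proof -
  have nb: "u \<in> tr_nbrs v" using c_nbr[OF v r] u by simp
  then obtain i where i: "u = v @ [i]" using u(2) by (elim nbr_cases) auto
  have u': "tree_vertex u" "u \<noteq> []" "butlast u = v" using nbr_vertex[OF v nb] i by auto
  have npv: "\<not> prefix u v" using i by (auto dest: prefix_length_le)
  then show "branch_next u \<rho>1 v = r"
    using final_config_outside[OF u'(1,2), of v \<rho>1] by (simp add: branch_next_def \<rho>1_def)
  have ag: "\<rho> x = \<rho>1 x" if "prefix u x" for x
    using that npv by (auto simp: \<rho>1_def)
  have "branch_escapes u \<rho> = branch_escapes u \<rho>1"
    using hits_local[OF u'(1,2) ag] by (simp add: branch_escapes_def)
  moreover have "branch_word u (branch_next u \<rho>) A = branch_word u (branch_next u \<rho>1) A"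
    using final_config_local[OF u'(1,2) ag] unfolding branch_next_def
    by (intro branch_word_local[OF u'(1,2)]) auto
  ultimately show "branch_word u \<rho> (x # A) \<longleftrightarrow>
      x = branch_escapes u \<rho>1 \<and> branch_word u (branch_next u \<rho>1) A"
    by simp
  fix r' assume r': "r' < 3" "r' \<noteq> r" "v = [] \<or> c v r' \<noteq> butlast v"
  have nb': "c v r' \<in> tr_nbrs v" using c_nbr[OF v r'(1)] .
  then obtain i' where i': "c v r' = v @ [i']" using r'(3) by (elim nbr_cases) auto
  have "c v r' \<noteq> u" using bij_c[OF v] r r' u(1) by (auto simp: bij_betw_def dest: inj_onD)
  then have np: "\<not> prefix u x \<and> x \<noteq> v" if "prefix (c v r') x" for x
    using that i i' by (auto simp: prefix_def)
  show "branch_word (c v r') (branch_next u \<rho>1) A = branch_word (c v r') \<rho> A"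
  proof (rule branch_word_local)
    show "tree_vertex (c v r')" "c v r' \<noteq> []" using nbr_vertex[OF v nb'] i' by auto
    show "branch_next u \<rho>1 x = \<rho> x" if "prefix (c v r') x" for x
      using final_config_outside[OF u'(1,2), of x \<rho>1] np[OF that]
      by (simp add: branch_next_def \<rho>1_def)
  qed
qed

lemma exists_escaping_config:
  assumes v: "tree_vertex v" "v \<noteq> []"
  shows "\<exists>\<rho>. rotor_config \<rho> \<and> branch_escapes v \<rho>"
proof -
  \<comment> \<open>The next direction is 1, or 2 if direction 1 leads to the parent; so a chip
    meeting a rotor not yet turned moves away from the origin.\<close>
  define \<rho> :: "nat list \<Rightarrow> nat" where "\<rho> x = (if c x 1 = butlast x then 1 else 0)" for x
  have down: "c x ((\<rho> x + 1) mod 3) \<noteq> butlast x" if "tree_vertex x" for x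
  proof -
    have "c x 1 \<noteq> c x 2" using bij_c[OF that] by (auto simp: bij_betw_def dest: inj_onD)
    moreover have "(\<rho> x + 1) mod 3 = (if c x 1 = butlast x then 2 else 1)" by (simp add: \<rho>_def)
    ultimately show ?thesis by auto
  qed
  \<comment> \<open>The chip descends one level per step, hence meets only rotors still in their
    initial position.\<close>
  have desc: "tree_vertex (snd (steps t (\<rho>, v))) \<and> length (snd (steps t (\<rho>, v))) = length v + t \<and>
      (\<forall>x. length v + t \<le> length x \<longrightarrow> fst (steps t (\<rho>, v)) x = \<rho> x)" for t
  proof (induction t)
    case 0
    then show ?case using v by simp
  next
    case (Suc t)
    obtain \<sigma> x where s: "steps t (\<rho>, v) = (\<sigma>, x)" by fastforce
    have IH: "tree_vertex x" "length x = length v + t" "\<forall>y. length v + t \<le> length y \<longrightarrow> \<sigma> y = \<rho> y"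
      using Suc s by auto
    have nb: "c x ((\<rho> x + 1) mod 3) \<in> tr_nbrs x" using c_nbr[OF IH(1)] by simp
    then obtain i where "c x ((\<rho> x + 1) mod 3) = x @ [i]"
      using down[OF IH(1)] by (elim nbr_cases) auto
    then show ?case using IH s nbr_vertex[OF IH(1) nb] by (auto simp: rstep_eq)
  qed
  have "snd (steps t (\<rho>, v)) \<noteq> butlast v" for t
    using desc[of t] v(2) by (metis diff_less le_add1 length_butlast length_greater_0_conv
      not_le zero_less_one)
  then have "branch_escapes v \<rho>" unfolding branch_escapes_def hits_def by blast
  moreover have "rotor_config \<rho>" by (simp add: rotor_config_def \<rho>_def)
  ultimately show ?thesis by blast
qed

end

section \<open>Words of a branch and of its two children\<close>

locale rotor_branch = rotor_tree +
  fixes v :: "nat list" and p :: nat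
  assumes v: "tree_vertex v" "v \<noteq> []" and p: "p < 3" "c v p = butlast v"
begin

text \<open>Children are numbered in the order in which the rotor serves them after the
  parent.\<close>

definition child :: "nat \<Rightarrow> nat list" where
  "child d = c v ((p + 1 + d) mod 3)"

lemma child_nbr:
  assumes "d < 2"
  shows "child d \<noteq> butlast v" "child d \<in> tr_nbrs v"
proof -
  have "(p + 1 + d) mod 3 \<noteq> p" using mod3_shift_neq[OF p(1) assms] by simp
  then show "child d \<noteq> butlast v"
    unfolding child_def p(2)[symmetric] using bij_c[OF v(1)] p(1)
    by (auto simp: bij_betw_def dest: inj_onD)
  show "child d \<in> tr_nbrs v" unfolding child_def using c_nbr[OF v(1)] by simp
qed

text \<open>The phase \<open>d\<close> of a rotor counts its advances since it last pointed to the parent.\<close>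
definition phase :: "nat \<Rightarrow> (nat list \<Rightarrow> nat) \<Rightarrow> bool" where
  "phase d \<rho> \<longleftrightarrow> \<rho> v mod 3 = (p + d) mod 3"

text \<open>If the chip escapes through the child (\<open>b\<close>), the branch records a one.
  Otherwise the same chip comes back to \<open>v\<close> and continues, so no letter of the word of
  \<open>v\<close> is used up.\<close>

lemma visit_child:
  assumes "d < 2" "phase d \<rho>"
  obtains \<rho>' b where "phase (Suc d) \<rho>'"
    and "\<And>x A. branch_word (child d) \<rho> (x # A) \<longleftrightarrow> x = b \<and> branch_word (child d) \<rho>' A"
    and "\<And>A. branch_word (child (1 - d)) \<rho> A \<longleftrightarrow> branch_word (child (1 - d)) \<rho>' A"
    and "\<And>x w. branch_word v \<rho> (x # w) \<longleftrightarrow>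
      (if b then x \<and> branch_word v \<rho>' w else branch_word v \<rho>' (x # w))"
proof -
  define r where "r = (\<rho> v + 1) mod 3"
  have r: "r = (p + 1 + d) mod 3"
    using assms(2) mod_Suc_eq[of "\<rho> v" 3] mod_Suc_eq[of "p + d" 3]
    unfolding r_def phase_def by simp
  have u: "child d = c v r" "v = [] \<or> child d \<noteq> butlast v" "child d \<noteq> butlast v"
    using child_nbr[OF assms(1)] r by (auto simp: child_def)
  have r3: "r < 3" by (simp add: r_def)
  define \<rho>' where "\<rho>' = branch_next (child d) (\<rho>(v := r))"
  define b where "b = branch_escapes (child d) (\<rho>(v := r))"
  note visit = child_visit[OF v(1) r3 u(1,2), where \<rho> = \<rho>]
  define r' where "r' = (p + 1 + (1 - d)) mod 3"
  have "r' \<noteq> r"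
    using assms(1) unfolding r r'_def by (cases "d = 0") (auto simp: less_2_cases_iff mod_Suc)
  then have r': "r' < 3" "r' \<noteq> r" "v = [] \<or> c v r' \<noteq> butlast v" "c v r' = child (1 - d)"
    using child_nbr[of "1 - d"] unfolding r'_def child_def by simp_all
  show thesis
  proof (rule that[of \<rho>' b])
    show "phase (Suc d) \<rho>'"
      using visit(1) r by (simp add: phase_def \<rho>'_def)
    show "branch_word (child d) \<rho> (x # A) \<longleftrightarrow> x = b \<and> branch_word (child d) \<rho>' A" for x A
      using visit(2) by (simp add: \<rho>'_def b_def)
    show "branch_word (child (1 - d)) \<rho> A \<longleftrightarrow> branch_word (child (1 - d)) \<rho>' A" for A
      using visit(3)[OF r'(1-3)] r'(4) by (simp add: \<rho>'_def)
    show "branch_word v \<rho> (x # w) \<longleftrightarrow>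
        (if b then x \<and> branch_word v \<rho>' w else branch_word v \<rho>' (x # w))" for x w
      using branch_to_child[OF v, of "child d" \<rho>] u(1,3)
      by (auto simp: \<rho>'_def b_def r_def)
  qed
qed

lemma visit_parent:
  assumes "phase 2 \<rho>"
  obtains \<rho>' where "phase 0 \<rho>'"
    and "\<And>d A. d < 2 \<Longrightarrow> branch_word (child d) \<rho> A \<longleftrightarrow> branch_word (child d) \<rho>' A"
    and "\<And>x w. branch_word v \<rho> (x # w) \<longleftrightarrow> \<not> x \<and> branch_word v \<rho>' w"
proof -
  have r: "(\<rho> v + 1) mod 3 = p"
    using assms p(1) mod_Suc_eq[of "\<rho> v" 3] mod_Suc_eq[of "p + 2" 3]
    unfolding phase_def by simp
  show thesis
  proof (rule that[of "\<rho>(v := p)"])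
    show "phase 0 (\<rho>(v := p))" by (simp add: phase_def)
    show "branch_word v \<rho> (x # w) \<longleftrightarrow> \<not> x \<and> branch_word v (\<rho>(v := p)) w" for x w
      using branch_to_parent[OF v(2), of \<rho>] r p(2) by simp
    show "branch_word (child d) \<rho> A \<longleftrightarrow> branch_word (child d) (\<rho>(v := p)) A" if d: "d < 2" for d A
    proof (rule branch_word_local)
      obtain i where i: "child d = v @ [i]"
        using child_nbr[OF d] by (elim nbr_cases) auto
      show "tree_vertex (child d)" "child d \<noteq> []"
        using i nbr_vertex[OF v(1) child_nbr(2)[OF d]] by auto
      show "\<rho> x = (\<rho>(v := p)) x" if "prefix (child d) x" for x
        using that i by auto
    qed
  qed
qed

text \<open>Every one of \<open>w\<close> is a one of some child. The zeros of \<open>w\<close> mark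
  the visits to the parent, and each child is served at most once per round. The letter beyond
  \<open>zeros w\<close> belongs to a child not yet served in the initial round: child 0 in phase 0,
  child 1 in phases 0 and 1.\<close>

lemma branch_word_split:
  assumes "branch_word v \<rho> w" "phase d \<rho>" "d < 3"
  shows "\<exists>A B. branch_word (child 0) \<rho> A \<and> branch_word (child 1) \<rho> B \<and>
    count_ones w = count_ones A + count_ones B \<and>
    length A \<le> zeros w + of_bool (d = 0) \<and> length B \<le> zeros w + of_bool (d < 2)"
  using assms
proof (induction w arbitrary: \<rho> d)
  case Nil
  show ?case by (rule exI[of _ "[]"], rule exI[of _ "[]"]) simp
next
  case (Cons x w)
  let ?G = "\<lambda>d \<rho>. \<exists>A B. branch_word (child 0) \<rho> A \<and> branch_word (child 1) \<rho> B \<and>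
    count_ones (x # w) = count_ones A + count_ones B \<and>
    length A \<le> zeros (x # w) + of_bool (d = 0) \<and> length B \<le> zeros (x # w) + of_bool (d < (2::nat))"
  \<comment> \<open>An advance that records no letter leaves \<open>x # w\<close> in place, where
    the induction hypothesis does not apply. Hence the phases are treated from 2 down to 0: phase 2
    always records a letter, and phases 1 and 0 can fall back on the following one.\<close>
  have G2: "?G 2 \<rho>" if h: "branch_word v \<rho> (x # w)" "phase 2 \<rho>" for \<rho>
  proof -
    obtain \<rho>' where \<rho>': "phase 0 \<rho>'"
      "\<And>d A. d < 2 \<Longrightarrow> branch_word (child d) \<rho> A \<longleftrightarrow> branch_word (child d) \<rho>' A"
      "\<And>x w. branch_word v \<rho> (x # w) \<longleftrightarrow> \<not> x \<and> branch_word v \<rho>' w"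
      using visit_parent[OF h(2)] by metis
    have "\<not> x" "branch_word v \<rho>' w" using \<rho>'(3) h(1) by auto
    with Cons.IH[of \<rho>' 0] \<rho>'(1,2) show ?thesis by fastforce
  qed
  have G1: "?G 1 \<rho>" if h: "branch_word v \<rho> (x # w)" "phase 1 \<rho>" for \<rho>
  proof -
    obtain \<rho>' b where \<rho>': "phase 2 \<rho>'"
      "\<And>x A. branch_word (child 1) \<rho> (x # A) \<longleftrightarrow> x = b \<and> branch_word (child 1) \<rho>' A"
      "\<And>A. branch_word (child 0) \<rho> A \<longleftrightarrow> branch_word (child 0) \<rho>' A"
      "\<And>x w. branch_word v \<rho> (x # w) \<longleftrightarrow>
        (if b then x \<and> branch_word v \<rho>' w else branch_word v \<rho>' (x # w))"
      using visit_child[of 1 \<rho>] h(2) by (auto simp: numeral_2_eq_2)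
    obtain A B where "branch_word (child 0) \<rho>' A" "branch_word (child 1) \<rho>' B"
      "count_ones (x # w) = count_ones A + count_ones (b # B)"
      "length A \<le> zeros (x # w)" "length (b # B) \<le> zeros (x # w) + 1"
    proof (cases b)
      case True
      then have "x" "branch_word v \<rho>' w" using h(1) \<rho>'(4) by auto
      with True Cons.IH[of \<rho>' 2] \<rho>'(1) that show ?thesis by fastforce
    next
      case False
      then have "branch_word v \<rho>' (x # w)" using h(1) \<rho>'(4) by auto
      with False G2[of \<rho>'] \<rho>'(1) that show ?thesis by fastforce
    qed
    then show ?thesis using \<rho>'(2,3) by (intro exI[of _ A] exI[of _ "b # B"]) auto
  qed
  have G0: "?G 0 \<rho>" if h: "branch_word v \<rho> (x # w)" "phase 0 \<rho>" for \<rho>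
  proof -
    obtain \<rho>' b where \<rho>': "phase 1 \<rho>'"
      "\<And>x A. branch_word (child 0) \<rho> (x # A) \<longleftrightarrow> x = b \<and> branch_word (child 0) \<rho>' A"
      "\<And>A. branch_word (child 1) \<rho> A \<longleftrightarrow> branch_word (child 1) \<rho>' A"
      "\<And>x w. branch_word v \<rho> (x # w) \<longleftrightarrow>
        (if b then x \<and> branch_word v \<rho>' w else branch_word v \<rho>' (x # w))"
      using visit_child[of 0 \<rho>] h(2) by auto
    obtain A B where "branch_word (child 0) \<rho>' A" "branch_word (child 1) \<rho>' B"
      "count_ones (x # w) = count_ones (b # A) + count_ones B"
      "length (b # A) \<le> zeros (x # w) + 1" "length B \<le> zeros (x # w) + 1"
    proof (cases b)
      case True
      then have "x" "branch_word v \<rho>' w" using h(1) \<rho>'(4) by auto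
      with True Cons.IH[of \<rho>' 1] \<rho>'(1) that show ?thesis by fastforce
    next
      case False
      then have "branch_word v \<rho>' (x # w)" using h(1) \<rho>'(4) by auto
      with False G1[of \<rho>'] \<rho>'(1) that show ?thesis by fastforce
    qed
    then show ?thesis using \<rho>'(2,3) by (intro exI[of _ "b # A"] exI[of _ B]) auto
  qed
  have "d = 0 \<or> d = 1 \<or> d = 2" using Cons.prems(3) by linarith
  then show ?case using G0 G1 G2 Cons.prems(1,2) by blast
qed

text \<open>A full round turns the letters \<open>a\<close> and \<open>b\<close> of the children
  into as many ones followed by a zero. Words stopping before that zero are listed separately, to
  match the clauses of \<open>half\<close>.\<close>

lemma visit_both_children:
  assumes "phase 0 \<rho>" "branch_word (child 0) \<rho> (a # A)" "branch_word (child 1) \<rho> (b # B)"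
  obtains \<rho>2 where "phase 0 \<rho>2" "branch_word (child 0) \<rho>2 A" "branch_word (child 1) \<rho>2 B"
    and "branch_word v \<rho> [True] \<longleftrightarrow> a \<or> b"
    and "\<And>w. branch_word v \<rho> (False # w) \<longleftrightarrow> \<not> a \<and> \<not> b \<and> branch_word v \<rho>2 w"
    and "\<And>w. a \<noteq> b \<Longrightarrow> branch_word v \<rho> (True # False # w) \<longleftrightarrow> branch_word v \<rho>2 w"
    and "a \<Longrightarrow> b \<Longrightarrow> branch_word v \<rho> [True, True]"
    and "\<And>w. a \<Longrightarrow> b \<Longrightarrow> branch_word v \<rho> (True # True # False # w) \<longleftrightarrow> branch_word v \<rho>2 w"
proof -
  obtain \<rho>' where \<rho>': "phase 1 \<rho>'" "branch_word (child 0) \<rho>' A" "branch_word (child 1) \<rho>' (b # B)"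
    "\<And>x w. branch_word v \<rho> (x # w) \<longleftrightarrow>
      (if a then x \<and> branch_word v \<rho>' w else branch_word v \<rho>' (x # w))"
    using visit_child[of 0 \<rho>] assms by (metis One_nat_def diff_zero zero_less_numeral)
  obtain \<rho>'' where \<rho>'': "phase 2 \<rho>''" "branch_word (child 0) \<rho>'' A" "branch_word (child 1) \<rho>'' B"
    "\<And>x w. branch_word v \<rho>' (x # w) \<longleftrightarrow>
      (if b then x \<and> branch_word v \<rho>'' w else branch_word v \<rho>'' (x # w))"
    using visit_child[of 1 \<rho>'] \<rho>'(1-3) by (metis One_nat_def Suc_1 diff_self_eq_0 lessI)
  obtain \<rho>2 where \<rho>2: "phase 0 \<rho>2" "branch_word (child 0) \<rho>2 A" "branch_word (child 1) \<rho>2 B"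
    "\<And>x w. branch_word v \<rho>'' (x # w) \<longleftrightarrow> \<not> x \<and> branch_word v \<rho>2 w"
    using visit_parent[OF \<rho>''(1)] \<rho>''(2,3) by (metis one_less_numeral_iff semiring_norm(76) zero_less_numeral)
  show thesis
    by (rule that[of \<rho>2]) (use \<rho>2 \<rho>'(4) \<rho>''(4) in \<open>auto simp del: branch_word.simps(2)\<close>)
qed

text \<open>Each clause of \<open>half\<close> is one round. The opposite flags send a single one to
  exactly one child, and sparsity makes two ones be followed by a zero or by the end of the
  word.\<close>

lemma branch_word_merge:
  assumes "sparse w" "phase 0 \<rho>"
    "branch_word (child 0) \<rho> (half t w)" "branch_word (child 1) \<rho> (half (\<not> t) w)"
  shows "branch_word v \<rho> w"
  using assms
proof (induction t w arbitrary: \<rho> rule: half.induct)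
  case (1 t)
  then show ?case by simp
next
  case (2 t w)
  have "sparse w" using sparse_sublist[OF "2.prems"(1)] by (simp add: sublist_Cons_right)
  note IH = "2.IH"[OF this]
  have "branch_word (child 0) \<rho> (False # half t w)"
    "branch_word (child 1) \<rho> (False # half (\<not> t) w)"
    using "2.prems"(3,4) by (simp_all only: half.simps)
  then show ?case
    by (rule visit_both_children[OF "2.prems"(2)]) (simp only: IH simp_thms)
next
  case (3 t)
  have "branch_word (child 0) \<rho> [t]" "branch_word (child 1) \<rho> [\<not> t]"
    using "3.prems"(3,4) by (simp_all only: half.simps)
  then show ?case
    by (rule visit_both_children[OF "3.prems"(2)]) (simp only: simp_thms)
next
  case (4 t w)
  have "sparse w" using sparse_sublist[OF "4.prems"(1)] by (simp add: sublist_Cons_right)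
  note IH = "4.IH"[OF this]
  have "branch_word (child 0) \<rho> (t # half (\<not> t) w)"
    "branch_word (child 1) \<rho> ((\<not> t) # half (\<not> \<not> t) w)"
    using "4.prems"(3,4) by (simp_all only: half.simps)
  then show ?case
  proof (rule visit_both_children[OF "4.prems"(2)])
    fix \<rho>2
    assume "phase 0 \<rho>2" "branch_word (child 0) \<rho>2 (half (\<not> t) w)"
      "branch_word (child 1) \<rho>2 (half (\<not> \<not> t) w)"
      and step: "\<And>w. t \<noteq> (\<not> t) \<Longrightarrow>
        branch_word v \<rho> (True # False # w) \<longleftrightarrow> branch_word v \<rho>2 w"
    from IH[OF this(1-3)] step[of w] show ?thesis by blast
  qed
next
  case (5 t w)
  have "branch_word (child 0) \<rho> (True # half t (tl w))"
    "branch_word (child 1) \<rho> (True # half (\<not> t) (tl w))"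
    using "5.prems"(3,4) by (simp_all only: half.simps)
  then show ?case
  proof (rule visit_both_children[OF "5.prems"(2)])
    fix \<rho>2
    assume \<rho>2: "phase 0 \<rho>2" "branch_word (child 0) \<rho>2 (half t (tl w))"
      "branch_word (child 1) \<rho>2 (half (\<not> t) (tl w))"
      and stop: "True \<Longrightarrow> True \<Longrightarrow> branch_word v \<rho> [True, True]"
      and step: "\<And>w. True \<Longrightarrow> True \<Longrightarrow>
        branch_word v \<rho> (True # True # False # w) \<longleftrightarrow> branch_word v \<rho>2 w"
    show ?thesis
    proof (cases w)
      case Nil
      then show ?thesis using stop by blast
    next
      case (Cons b w')
      then have w: "w = False # w'" using "5.prems"(1) not_sparse_111 by (cases b) auto
      then have "sparse (tl w)"
        using sparse_sublist[OF "5.prems"(1)] by (simp add: sublist_Cons_right)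
      then have "branch_word v \<rho>2 w'" using "5.IH"[OF _ \<rho>2] w by simp
      then show ?thesis using step w by blast
    qed
  qed
qed

end

section \<open>The words of a single branch are exactly the sparse ones\<close>

context rotor_tree
begin

lemma rotor_branch_exists:
  assumes "tree_vertex v" "v \<noteq> []"
  obtains p where "rotor_branch c v p"
proof -
  obtain p where "p < 3" "c v p = butlast v"
    using bij_betw_imp_surj_on[OF bij_c[OF assms(1)]] parent_nbr[OF assms]
    by (metis imageE lessThan_iff)
  then have "rotor_branch c v p" using assms by unfold_locales auto
  then show thesis by (rule that)
qed

lemma branch_word_sublist:
  "branch_word v \<rho> w \<Longrightarrow> sublist q w \<Longrightarrow> \<exists>\<rho>'. branch_word v \<rho>' q"
proof -
  have pre: "branch_word v \<rho> (q @ r) \<Longrightarrow> branch_word v \<rho> q" for \<rho> q r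
    by (induction q arbitrary: \<rho>) auto
  have suf: "branch_word v \<rho> (p @ q) \<Longrightarrow> \<exists>\<rho>'. branch_word v \<rho>' q" for \<rho> p q
    by (induction p arbitrary: \<rho>) auto
  show "branch_word v \<rho> w \<Longrightarrow> sublist q w \<Longrightarrow> \<exists>\<rho>'. branch_word v \<rho>' q"
    using pre suf unfolding sublist_def by blast
qed

text \<open>More than 2^(k+1) ones among fewer than 2^(k+2) letters leave at most 2^(k+1) - 2 zeros,
  so each child contributes fewer than 2^(k+1) letters and, inductively, at most 2^k ones.\<close>

lemma branch_word_few_ones:
  assumes "tree_vertex v" "v \<noteq> []" "branch_word v \<rho> w" "length w < 2 ^ Suc k"
  shows "count_ones w \<le> 2 ^ k"
  using assms
proof (induction k arbitrary: v \<rho> w)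
  case 0
  then show ?case using count_ones_le_length[of w] by simp
next
  case (Suc k)
  obtain p where "rotor_branch c v p" using rotor_branch_exists Suc.prems(1,2) by blast
  then interpret rotor_branch c v p .
  show ?case
  proof (rule ccontr)
    assume many: "\<not> ?thesis"
    \<comment> \<open>The phase is \<open>\<rho> v - p\<close> modulo 3, written with
      \<open>3 - p\<close> to stay within the naturals.\<close>
    have "\<exists>d<3. phase d \<rho>" unfolding phase_def using p(1)
      by (intro exI[of _ "(\<rho> v + (3 - p)) mod 3"]) (simp add: mod_simps)
    then obtain d where d: "d < 3" "phase d \<rho>" by blast
    obtain A B where AB: "branch_word (child 0) \<rho> A" "branch_word (child 1) \<rho> B"
      "count_ones w = count_ones A + count_ones B"
      "length A \<le> zeros w + 1" "length B \<le> zeros w + 1"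
    proof -
      have "of_bool (d = 0) \<le> (1::nat)" "of_bool (d < 2) \<le> (1::nat)" by simp_all
      then show thesis
        using branch_word_split[OF Suc.prems(3) d(2,1)] that by (meson add_left_mono order_trans)
    qed
    have len: "length A < 2 ^ Suc k" "length B < 2 ^ Suc k"
      using many Suc.prems(4) ones_plus_zeros[of w] AB(4,5) by auto
    have child: "tree_vertex (child d)" "child d \<noteq> []" if "d < 2" for d
      using child_nbr[OF that] nbr_vertex[OF v(1)] by (auto elim!: nbr_cases)
    have "count_ones A \<le> 2 ^ k" "count_ones B \<le> 2 ^ k"
      using Suc.IH[OF _ _ AB(1) len(1)] Suc.IH[OF _ _ AB(2) len(2)] child by auto
    then show False using many AB(3) by simp
  qed
qed

lemma branch_word_sparse:
  "tree_vertex v \<Longrightarrow> v \<noteq> [] \<Longrightarrow> branch_word v \<rho> w \<Longrightarrow> sparse w"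
  unfolding sparse_def using branch_word_sublist branch_word_few_ones by blast

lemma sparse_realizable:
  assumes "tree_vertex v" "v \<noteq> []" "sparse w"
  shows "\<exists>\<rho>. rotor_config \<rho> \<and> branch_word v \<rho> w"
  using assms
proof (induction "length w" arbitrary: v w rule: less_induct)
  case less
  obtain p where "rotor_branch c v p" using rotor_branch_exists less.prems(1,2) by blast
  then interpret rotor_branch c v p .
  \<comment> \<open>The branches of the two children are disjoint and \<open>v\<close> lies in
    neither, so both configurations and the phase can be prescribed independently.\<close>
  have glue: "\<exists>\<rho>. rotor_config \<rho> \<and> phase d \<rho> \<and> branch_word (child 0) \<rho> A \<and> branch_word (child 1) \<rho> B"
    if AB: "length A < length w" "length B < length w" "sparse A" "sparse B" for A B d
  proof -
    have child: "tree_vertex (child d)" "child d \<noteq> []" "\<exists>i. child d = v @ [i]" if "d < 2" for d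
      using child_nbr[OF that] nbr_vertex[OF v(1)] by (auto elim!: nbr_cases)
    obtain \<rho>A where A: "rotor_config \<rho>A" "branch_word (child 0) \<rho>A A"
      using less.hyps[OF AB(1)] child[of 0] AB(3) by auto
    obtain \<rho>B where B: "rotor_config \<rho>B" "branch_word (child 1) \<rho>B B"
      using less.hyps[OF AB(2)] child[of 1] AB(4) by auto
    obtain i j where ij: "child 0 = v @ [i]" "child 1 = v @ [j]" using child(3) by fastforce
    have "(p + 1 + 0) mod 3 \<noteq> (p + 1 + 1) mod 3" by (simp add: mod_Suc)
    then have "child 0 \<noteq> child 1" unfolding child_def using bij_c[OF v(1)]
      by (auto simp: bij_betw_def dest: inj_onD)
    then have "i \<noteq> j" using ij by auto
    define \<rho> where "\<rho> x = (if prefix (child 0) x then \<rho>A x else if prefix (child 1) x then \<rho>B x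
      else (p + d) mod 3)" for x
    have "rotor_config \<rho>" using A(1) B(1) by (simp add: rotor_config_def \<rho>_def)
    moreover have "phase d \<rho>" unfolding phase_def \<rho>_def ij by simp
    moreover have "branch_word (child 0) \<rho> A"
      using A(2) branch_word_local[OF child(1,2), of 0 \<rho> \<rho>A] by (simp add: \<rho>_def)
    moreover have "\<rho> x = \<rho>B x" if "prefix (child 1) x" for x
      using that \<open>i \<noteq> j\<close> unfolding \<rho>_def ij by (auto simp: prefix_def)
    then have "branch_word (child 1) \<rho> B"
      using B(2) branch_word_local[OF child(1,2), of 1 \<rho> \<rho>B] by simp
    ultimately show ?thesis by blast
  qed
  consider "w = []" | w' where "w = False # w'" | "w = [True]" | b w' where "w = True # b # w'"
    by (metis (full_types) neq_Nil_conv)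
  then show ?case
  proof cases
    case 1
    then show ?thesis by (intro exI[of _ "\<lambda>_. 0"]) (simp add: rotor_config_def)
  next
    \<comment> \<open>In phase 2 the first chip goes straight to the parent and yields the leading
      zero, so the children need only the halves of \<open>w'\<close>.\<close>
    case (2 w')
    have sp: "sparse w'"
      using sparse_sublist[OF less.prems(3)] 2 by (simp add: sublist_Cons_right)
    obtain \<rho> where \<rho>: "rotor_config \<rho>" "phase 2 \<rho>"
      "branch_word (child 0) \<rho> (half True w')" "branch_word (child 1) \<rho> (half False w')"
      using glue[of "half True w'" "half False w'" 2] sp sparse_half length_half 2
      by (metis length_Cons less_Suc_eq_le)
    obtain \<rho>' where "phase 0 \<rho>'" "branch_word (child 0) \<rho>' (half True w')"
      "branch_word (child 1) \<rho>' (half False w')"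
      "\<And>x w. branch_word v \<rho> (x # w) \<longleftrightarrow> \<not> x \<and> branch_word v \<rho>' w"
      using visit_parent[OF \<rho>(2)] \<rho>(3,4) by (metis one_less_numeral_iff semiring_norm(76) zero_less_numeral)
    then have "branch_word v \<rho> w"
      using branch_word_merge[OF sp, of \<rho>' True] 2 by (simp del: branch_word.simps)
    then show ?thesis using \<rho>(1) by blast
  next
    case 3
    then show ?thesis using exists_escaping_config[OF less.prems(1,2)] by auto
  next
    case (4 b w')
    obtain \<rho> where "rotor_config \<rho>" "phase 0 \<rho>"
      "branch_word (child 0) \<rho> (half True w)" "branch_word (child 1) \<rho> (half False w)"
      using glue[of "half True w" "half False w" 0] less.prems(3) sparse_half length_half_less 4 by metis
    then show ?thesis
      using branch_word_merge[OF less.prems(3), of \<rho> True] by auto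
  qed
qed

section \<open>The walk from the origin\<close>

lemma vertex_origin: "tree_vertex []"
  by (simp add: tree_vertex_def)

lemma origin_nbr:
  assumes "r < 3"
  shows "tree_vertex (c [] r)" "c [] r \<noteq> []" "length (c [] r) = 1" "butlast (c [] r) = []"
proof -
  have nb: "c [] r \<in> tr_nbrs []" using c_nbr[OF vertex_origin assms] .
  then show "tree_vertex (c [] r)" using nbr_vertex[OF vertex_origin] by blast
  show "c [] r \<noteq> []" "length (c [] r) = 1" "butlast (c [] r) = []"
    using nb by (auto elim!: nbr_cases)
qed

text \<open>After the first step the chip moves in the branch of \<open>u\<close>, whose parent is
  the origin. The two descriptions differ by a time shift of one, since the start at time 0 does not
  count as a return.\<close>

lemma walk_from_origin:
  fixes \<rho>
  defines "r \<equiv> (\<rho> [] + 1) mod 3"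
  defines "u \<equiv> c [] r" and "\<rho>1 \<equiv> \<rho>([] := r)"
  shows "returns c \<rho> \<longleftrightarrow> \<not> branch_escapes u \<rho>1"
    and "escapes c \<rho> \<longleftrightarrow> branch_escapes u \<rho>1"
    and "returns c \<rho> \<Longrightarrow> return_config c \<rho> = branch_next u \<rho>1"
    and "escapes c \<rho> \<Longrightarrow> escape_config c \<rho> = branch_next u \<rho>1"
proof -
  have u: "tree_vertex u" "u \<noteq> []" "butlast u = []"
    unfolding u_def r_def by (simp_all add: origin_nbr)
  have walk_0: "walk c \<rho> t = steps t (\<rho>, [])" for t
    by (simp add: walk_def origin_def)
  have walk_Suc: "walk c \<rho> (Suc t) = steps t (\<rho>1, u)" for t
    unfolding walk_0 steps_Suc by (simp add: rstep_eq u_def \<rho>1_def r_def)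
  have "returns c \<rho> \<longleftrightarrow> (\<exists>t. snd (walk c \<rho> (Suc t)) = [])"
    unfolding returns_def origin_def by (metis gr0_implies_Suc zero_less_Suc)
  then show ret: "returns c \<rho> \<longleftrightarrow> \<not> branch_escapes u \<rho>1"
    unfolding walk_Suc branch_escapes_def hits_def u(3) by simp
  have "finite {t. snd (walk c \<rho> t) = x}" if "branch_escapes u \<rho>1" for x
  proof -
    have "{t. snd (walk c \<rho> t) = x} \<subseteq> insert 0 (Suc ` {t. snd (steps t (\<rho>1, u)) = x})"
      using walk_Suc by (auto simp: image_iff) (metis not0_implies_Suc)
    then show ?thesis using finite_visits[OF u(1,2) that] by (meson finite.insertI finite_imageI finite_subset)
  qed
  then show esc: "escapes c \<rho> \<longleftrightarrow> branch_escapes u \<rho>1"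
    unfolding escapes_def ret by blast
  show "return_config c \<rho> = branch_next u \<rho>1" if returns: "returns c \<rho>"
  proof -
    obtain n where n: "n > 0" "snd (walk c \<rho> n) = []"
      using returns unfolding returns_def origin_def by blast
    then have "(LEAST t. t > 0 \<and> snd (walk c \<rho> t) = origin) =
        Suc (LEAST t. Suc t > 0 \<and> snd (walk c \<rho> (Suc t)) = origin)"
      by (intro Least_Suc[of _ n]) (auto simp: origin_def)
    also have "\<dots> = Suc (LEAST t. snd (steps t (\<rho>1, u)) = [])"
      by (simp only: walk_Suc origin_def zero_less_Suc simp_thms)
    finally show ?thesis
      using returns ret u(3) unfolding return_config_def
      by (simp add: walk_Suc branch_next_def branch_escapes_def final_config_def)
  qed
  show "escape_config c \<rho> = branch_next u \<rho>1" if "escapes c \<rho>"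
  proof -
    have "escape_config c \<rho> = limit_config (\<rho>, [])"
      unfolding escape_config_def limit_config_def walk_0 ..
    also have "\<dots> = limit_config (\<rho>1, u)"
      using limit_config_rstep[of "(\<rho>, [])"] by (simp add: rstep_eq u_def \<rho>1_def r_def)
    finally show ?thesis
      using that esc u(3) by (simp add: branch_next_def branch_escapes_def final_config_def)
  qed
qed

end

section \<open>Distributing the chips over the three branches at the origin\<close>

lemma subseq3_Nil [simp]: "subseq3 j [] = []"
  by (simp add: subseq3_def)

text \<open>Deleting the first letter permutes the residue classes cyclically, just as one chip
  advances the rotor at the origin.\<close>

lemma subseq3_Cons:
  "subseq3 0 (b # w) = b # subseq3 2 w"
  "subseq3 (Suc 0) (b # w) = subseq3 0 w"
  "subseq3 2 (b # w) = subseq3 (Suc 0) w"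
proof -
  have upt: "[0..<length (b # w)] = 0 # map Suc [0..<length w]"
    by (simp add: upt_conv_Cons map_Suc_upt del: upt_Suc)
  have m: "Suc i mod 3 = 0 \<longleftrightarrow> i mod 3 = 2" "Suc i mod 3 = Suc 0 \<longleftrightarrow> i mod 3 = 0"
    "Suc i mod 3 = 2 \<longleftrightarrow> i mod 3 = Suc 0" for i :: nat
    by presburger+
  show "subseq3 0 (b # w) = b # subseq3 2 w" "subseq3 (Suc 0) (b # w) = subseq3 0 w"
    "subseq3 2 (b # w) = subseq3 (Suc 0) w"
    unfolding subseq3_def upt by (simp_all add: comp_def m cong: if_cong)
qed

context rotor_tree
begin

text \<open>A chip leaves the words of the other two branches unchanged. The branch just served
  becomes the last in the new order, so its remaining letters are \<open>subseq3 2\<close> of the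
  tail.\<close>

lemma is_escape_seq_iff_branch_words:
  "is_escape_seq c \<rho> a \<longleftrightarrow>
     (\<forall>j<3. branch_word (c [] ((\<rho> [] + 1 + j) mod 3)) \<rho> (subseq3 j a))"
proof (induction a arbitrary: \<rho>)
  case Nil
  then show ?case by simp
next
  case (Cons b w)
  define r where "r = (\<rho> [] + 1) mod 3"
  define \<rho>' where "\<rho>' = branch_next (c [] r) (\<rho>([] := r))"
  have r: "r < 3" by (simp add: r_def)
  note visit = child_visit[OF vertex_origin r refl, where \<rho> = \<rho>, folded \<rho>'_def]
  have "is_escape_seq c \<rho> (b # w) \<longleftrightarrow>
      b = branch_escapes (c [] r) (\<rho>([] := r)) \<and> is_escape_seq c \<rho>' w"
    using walk_from_origin[of \<rho>, folded r_def] by (auto simp: \<rho>'_def)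
  also have "is_escape_seq c \<rho>' w \<longleftrightarrow>
      (\<forall>j<3. branch_word (c [] ((r + 1 + j) mod 3)) \<rho>' (subseq3 j w))"
    using Cons.IH[of \<rho>'] visit(1) by simp
  also have "b = branch_escapes (c [] r) (\<rho>([] := r)) \<and> \<dots> \<longleftrightarrow>
      (\<forall>j<3. branch_word (c [] ((\<rho> [] + 1 + j) mod 3)) \<rho> (subseq3 j (b # w)))"
  proof -
    have all3: "(\<forall>j<3. P j) \<longleftrightarrow> P 0 \<and> P (Suc 0) \<and> P 2" for P :: "nat \<Rightarrow> bool"
      by (auto simp: numeral_3_eq_3 numeral_2_eq_2 less_Suc_eq)
    have m: "(r + 1 + 2) mod 3 = r" "(\<rho> [] + 1 + 0) mod 3 = r"
      "(\<rho> [] + 1 + Suc 0) mod 3 = (r + 1) mod 3" "(\<rho> [] + 1 + 2) mod 3 = (r + 2) mod 3"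
      "(r + 1 + 0) mod 3 = (r + 1) mod 3" "(r + 1 + Suc 0) mod 3 = (r + 2) mod 3"
      unfolding r_def by (simp_all add: mod_simps)
    have ne: "(r + 1) mod 3 \<noteq> r" "(r + 2) mod 3 \<noteq> r"
      using mod3_shift_neq[OF r, of 0] mod3_shift_neq[OF r, of 1] by (simp_all add: numeral_2_eq_2)
    have other: "branch_word (c [] r') \<rho>' A = branch_word (c [] r') \<rho> A" if "r' < 3" "r' \<noteq> r" for r' A
      using visit(3) that by simp
    show ?thesis
      unfolding all3 m subseq3_Cons using visit(2) other[OF _ ne(1)] other[OF _ ne(2)] by auto
  qed
  finally show ?case .
qed

lemma escape_seq_realizable:
  assumes "\<And>j. j < 3 \<Longrightarrow> sparse (subseq3 j a)"
  shows "\<exists>\<rho>. rotor_config \<rho> \<and> is_escape_seq c \<rho> a"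
proof -
  have "\<forall>j. \<exists>\<rho>. j < 3 \<longrightarrow> rotor_config \<rho> \<and> branch_word (c [] j) \<rho> (subseq3 j a)"
    using sparse_realizable origin_nbr assms by blast
  then obtain R where R: "\<And>j. j < 3 \<Longrightarrow> rotor_config (R j)"
    "\<And>j. j < 3 \<Longrightarrow> branch_word (c [] j) (R j) (subseq3 j a)" by metis
  \<comment> \<open>The value 2 at the origin makes the first chip leave in direction 0, so that
    \<open>subseq3 j a\<close> becomes the word of the branch at \<open>c [] j\<close>.\<close>
  define \<rho> where "\<rho> x = (if \<exists>j<3. prefix (c [] j) x then R (THE j. j < 3 \<and> prefix (c [] j) x) x else 2)" for x
  have uniq: "(THE j. j < 3 \<and> prefix (c [] j) x) = j" if j: "j < 3" "prefix (c [] j) x" for j x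
  proof (rule the_equality)
    show "j < 3 \<and> prefix (c [] j) x" using j by simp
    fix i assume i: "i < 3 \<and> prefix (c [] i) x"
    then have "c [] i = c [] j"
      using j origin_nbr(3) by (metis prefix_length_prefix prefix_order.antisym order_refl)
    then show "i = j" using bij_c[OF vertex_origin] i j by (auto simp: bij_betw_def dest: inj_onD)
  qed
  have sub: "\<rho> x = R j x" if "j < 3" "prefix (c [] j) x" for j x
    using uniq[OF that] that by (auto simp: \<rho>_def)
  have "\<rho> [] = 2" using origin_nbr(2) by (auto simp: \<rho>_def)
  then have "(\<rho> [] + 1 + j) mod 3 = j" if "j < 3" for j
    using that by simp
  moreover have "branch_word (c [] j) \<rho> (subseq3 j a)" if "j < 3" for j
    using R(2)[OF that] branch_word_local[OF origin_nbr(1,2)[OF that], of \<rho> "R j"] sub[OF that]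
    by simp
  ultimately have "is_escape_seq c \<rho> a"
    unfolding is_escape_seq_iff_branch_words by simp
  moreover have "\<rho> x < 3" for x
  proof (cases "\<exists>j<3. prefix (c [] j) x")
    case True
    then show ?thesis using sub R(1) unfolding rotor_config_def by metis
  next
    case False
    then have "\<rho> x = 2" unfolding \<rho>_def by (rule if_not_P)
    then show ?thesis by simp
  qed
  ultimately show ?thesis unfolding rotor_config_def by blast
qed

lemma escape_seq_sparse:
  assumes "is_escape_seq c \<rho> a" "j < 3"
  shows "sparse (subseq3 j a)"
  using assms branch_word_sparse origin_nbr unfolding is_escape_seq_iff_branch_words
  by (metis mod_less_divisor zero_less_numeral)

end

theorem mainTheorem9:
  fixes c :: "nat list \<Rightarrow> nat \<Rightarrow> nat list" and a :: "bool list"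
  assumes "cyclic_orders c"
  shows "(\<exists>\<rho>. rotor_config \<rho> \<and> is_escape_seq c \<rho> a) \<longleftrightarrow> escape_condition a"
proof -
  interpret rotor_tree c by unfold_locales (rule assms)
  show ?thesis
    unfolding escape_condition_iff_sparse using escape_seq_realizable escape_seq_sparse by blast
qed

end
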